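(* Let $n\ge 1$, $\epsilon>0$, and let $\ell\in\mathbb R^n$ be a fixed vector with $\sum_{i}\exp(\ell_i)=1$. For $t\in\mathbb R^n$ let $\eta^*=\eta^*(t)$ be the solution of $$\max_{\eta\ge 0}\ D_t(\eta),\qquad D_t(\eta)=-\eta\,\epsilon-(\eta+1)\log\sum_{i=1}^n\exp\left(\frac{t_i+\eta\,\ell_i}{\eta+1}\right),$$ and let $$q=\mathrm{softmax}\left(\frac{\eta^*\ell+t}{\eta^*+1}\right).$$ Let $t$ be a point with $\sum_i\exp(t_i)=1$. (1) If $\sum_i e^{t_i}(t_i-\ell_i)<\epsilon$ (the trust region constraint is inactive, $\eta^*=0$), then $\dfrac{\partial\eta^*}{\partial t}=0$. (2) If $\sum_i e^{t_i}(t_i-\ell_i)>\epsilon$ (the trust region constraint is violated, $\eta^*>0$), then $$\frac{\partial\eta^*}{\partial t}=\frac{1}{-(\mathbf 1+\log q-\ell)^{T}\,\frac{\partial q}{\partial\eta^*}}\,(\mathbf 1+\log q-\ell)^{T}\,\frac{\partial q}{\partial t},$$ where $$\frac{\partial q}{\partial t}=\frac{1}{\eta^*+1}\left(\mathrm{D}(q)-qq^{T}\right),\qquad \frac{\partial q}{\partial\eta^*}=\frac{1}{(\eta^*+1)^2}\left(\mathrm{D}(q)-qq^{T}\right)(\ell-t).$$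
   Context: Here $\ell$ is the vector of log-probabilities of an old distribution and $t$ the vector of log-probabilities of a target distribution; $\sum_i e^{t_i}(t_i-\ell_i)$ is the Kullback–Leibler divergence of the target from the old distribution. $\mathrm{softmax}(z)_i=e^{z_i}/\sum_j e^{z_j}$; $\log q$ is taken entrywise; $\mathbf 1$ is the all-ones vector; $\mathrm D(q)$ is the diagonal matrix with the entries of $q$ on the diagonal. The derivative $\partial\eta^*/\partial t$ is a row vector in $\mathbb R^{1\times n}$, the derivative of the map $t\mapsto\eta^*(t)$ defined on $\mathbb R^n$ by the displayed maximization. The symbols $\partial q/\partial t$ and $\partial q/\partial \eta^*$ in (2) denote the partial derivatives of $(t,\eta)\mapsto\mathrm{softmax}\left(\frac{\eta\ell+t}{\eta+1}\right)$ (with $\eta$, respectively $t$, held fixed), evaluated at $(t,\eta^* )$. *)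

theory Defs
  imports "HOL-Analysis.Analysis"
begin

definition softmax :: "real ^ 'n \<Rightarrow> real ^ 'n" where
  "softmax z = (\<chi> i. exp (z $ i) / (\<Sum>j\<in>UNIV. exp (z $ j)))"

definition log_vec :: "real ^ 'n \<Rightarrow> real ^ 'n" where
  "log_vec q = (\<chi> i. ln (q $ i))"

definition diag_mat :: "real ^ 'n \<Rightarrow> real ^ 'n ^ 'n" where
  "diag_mat q = (\<chi> i j. if i = j then q $ i else 0)"

definition outer_prod :: "real ^ 'n \<Rightarrow> real ^ 'n \<Rightarrow> real ^ 'n ^ 'n" where
  "outer_prod u v = (\<chi> i j. u $ i * v $ j)"

text \<open>The dual function of the trust region problem, with old log-probabilities \<open>l\<close>, target
  log-probabilities \<open>t\<close> and multiplier \<open>\<eta>\<close>.\<close>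

definition dual_fun :: "real \<Rightarrow> real ^ 'n \<Rightarrow> real ^ 'n \<Rightarrow> real \<Rightarrow> real" where
  "dual_fun \<epsilon> l t \<eta> =
     - \<eta> * \<epsilon> - (\<eta> + 1) * ln (\<Sum>i\<in>UNIV. exp ((t $ i + \<eta> * l $ i) / (\<eta> + 1)))"

text \<open>When \<open>\<epsilon> > 0\<close> and the entries of \<open>exp l\<close> sum to one, the maximizer exists and is
  unique for every \<open>t\<close>, normalized or not, so the definite description is proper.\<close>

definition eta_star :: "real \<Rightarrow> real ^ 'n \<Rightarrow> real ^ 'n \<Rightarrow> real" where
  "eta_star \<epsilon> l t = (THE \<eta>. is_arg_max (dual_fun \<epsilon> l t) (\<lambda>\<eta>. 0 \<le> \<eta>) \<eta>)"

definition mix_softmax :: "real ^ 'n \<Rightarrow> real ^ 'n \<Rightarrow> real \<Rightarrow> real ^ 'n" where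
  "mix_softmax l t \<eta> = softmax ((\<eta> *\<^sub>R l + t) /\<^sub>R (\<eta> + 1))"

end

(* The derivative of the dual function in eta is g(t, eta) = KL(q(t, eta) || exp l) - eps, where
   q(t, eta) = mix_softmax l t eta. Its own derivative in eta is -Var_q(t - l) / (eta + 1)^3, so g
   is nonincreasing in eta, and strictly decreasing unless t - l is constant; in that exceptional
   case q = exp l and g = -eps < 0. As eta tends to infinity, g tends to -eps. Hence the maximizer
   is 0 wherever g(t, 0) < 0, an open condition on t, and otherwise it is the zero of g(t, .), which
   depends continuously on t by monotonicity. Implicit differentiation of g(t, eta_star t) = 0 gives
   the formula. *)
theory Submission
  imports Defs
begin

section \<open>Implicit differentiation of a scalar equation\<close>

text \<open>Write h and k for the increments of y and g y. Expanding G along the graph of g gives A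
  h + c k = o(|h| + |k|). As c is nonzero, this first forces k = O(|h|), and then the error in k = -
  A h / c is o(|h|). The function g is given and continuous at x, so differentiability of G at one
  point is enough.\<close>

lemma has_derivative_implicit_scalar:
  fixes G :: "'a::real_normed_vector \<times> real \<Rightarrow> real" and g :: "'a \<Rightarrow> real"
  assumes G: "(G has_derivative (\<lambda>(h, k). A h + c * k)) (at (x, g x))"
    and A: "bounded_linear A" and "c \<noteq> 0" and cont: "isCont g x"
    and zero: "\<forall>\<^sub>F y in nhds x. G (y, g y) = 0"
  shows "(g has_derivative (\<lambda>h. - A h / c)) (at x)"
  unfolding has_derivative_within_alt2
proof (intro conjI allI impI)
  show "bounded_linear (\<lambda>h. - A h / c)"
    using bounded_linear_compose[OF bounded_linear_divide bounded_linear_minus[OF A]] .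
  fix e :: real assume "e > 0"
  obtain B where B: "B > 0" "\<And>h. norm (A h) \<le> norm h * B"
    using bounded_linear.pos_bounded[OF A] by blast
  \<comment> \<open>Chosen so that |h| + |k| \<le> L |h|: once d \<le> 1/2 allows half of |k| to be
    absorbed, |k| \<le> (2 B / |c| + 1) |h| remains. The bound d L \<le> e then closes the
    estimate.\<close>
  define L where "L = 2 * B / \<bar>c\<bar> + 2"
  have zero_x: "G (x, g x) = 0"
    using zero by (rule eventually_nhds_x_imp_x)
  have "L > 0" using B by (simp add: L_def add_nonneg_pos)
  define d where "d = min (1/2) (e / L)"
  have d: "0 < d" "d \<le> 1/2" "d * L \<le> e"
    using \<open>e > 0\<close> \<open>L > 0\<close> by (auto simp: d_def min_def field_simps)
  have "\<forall>\<^sub>F z in at (x, g x). norm (G z - G (x, g x) - (case z - (x, g x) of (h, k) \<Rightarrow> A h + c * k))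
      \<le> (d * \<bar>c\<bar>) * norm (z - (x, g x))"
    using G d \<open>c \<noteq> 0\<close> unfolding has_derivative_within_alt2 by simp
  \<comment> \<open>Both sides vanish at the centre, so the estimate passes from the punctured to
    the full neighbourhood and can be composed with y \<mapsto> (y, g y).\<close>
  then have "\<forall>\<^sub>F z in nhds (x, g x). norm (G z - G (x, g x) - (case z - (x, g x) of (h, k) \<Rightarrow> A h + c * k))
      \<le> (d * \<bar>c\<bar>) * norm (z - (x, g x))"
    using linear_0[OF bounded_linear.linear[OF A]] by (simp add: eventually_nhds_conv_at zero_prod_def)
  moreover have "filterlim (\<lambda>y. (y, g y)) (nhds (x, g x)) (at x)"
    using cont by (intro tendsto_Pair) (auto simp: isCont_def)
  ultimately have "\<forall>\<^sub>F y in at x. norm (G (y, g y) - G (x, g x) -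
      (case (y, g y) - (x, g x) of (h, k) \<Rightarrow> A h + c * k)) \<le> (d * \<bar>c\<bar>) * norm ((y, g y) - (x, g x))"
    by (rule eventually_compose_filterlim)
  moreover have "\<forall>\<^sub>F y in at x. G (y, g y) = 0"
    using zero by (simp add: eventually_nhds_conv_at)
  ultimately show "\<forall>\<^sub>F y in at x. norm (g y - g x - - A (y - x) / c) \<le> e * norm (y - x)"
  proof eventually_elim
    case (elim y)
    define h k where "h = y - x" and "k = g y - g x"
    have "\<bar>A h + c * k\<bar> \<le> d * \<bar>c\<bar> * norm (h, k)"
      using elim zero_x by (simp add: h_def k_def)
    also have "\<dots> \<le> d * \<bar>c\<bar> * (norm h + \<bar>k\<bar>)"
      using d norm_Pair_le[of h k] by (intro mult_left_mono) auto
    finally have "\<bar>A h + c * k\<bar> / \<bar>c\<bar> \<le> d * (norm h + \<bar>k\<bar>)"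
      using \<open>c \<noteq> 0\<close> by (simp add: field_simps)
    moreover have "\<bar>A h + c * k\<bar> / \<bar>c\<bar> = \<bar>k + A h / c\<bar>"
      unfolding abs_divide[symmetric] using \<open>c \<noteq> 0\<close> by (simp add: add_divide_distrib add.commute)
    ultimately have 1: "\<bar>k + A h / c\<bar> \<le> d * norm h + d * \<bar>k\<bar>"
      by (simp add: algebra_simps)
    have "\<bar>A h / c\<bar> \<le> norm h * B / \<bar>c\<bar>"
      using B(2)[of h] by (simp add: divide_right_mono)
    moreover have "d * norm h \<le> 1/2 * norm h" "d * \<bar>k\<bar> \<le> 1/2 * \<bar>k\<bar>"
      using d by (intro mult_right_mono; simp)+
    ultimately have "\<bar>k\<bar> \<le> 2 * (norm h * B / \<bar>c\<bar>) + norm h"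
      using 1 by linarith
    then have "norm h + \<bar>k\<bar> \<le> L * norm h"
      by (simp add: L_def algebra_simps)
    then have "d * (norm h + \<bar>k\<bar>) \<le> d * (L * norm h)"
      using d by (intro mult_left_mono) auto
    also have "\<dots> \<le> e * norm h"
      using mult_right_mono[OF d(3), of "norm h"] by (simp add: mult.assoc)
    finally show ?case
      using 1 by (simp add: h_def k_def algebra_simps)
  qed
qed

section \<open>Softmax, its Jacobian and relative entropy\<close>

lemmas has_derivative_vec_nth [derivative_intros] = bounded_linear.has_derivative[OF bounded_linear_vec_nth]

lemma has_derivative_vec_iff:
  fixes f :: "'a::real_normed_vector \<Rightarrow> real ^ 'n"
  shows "(f has_derivative f') (at x within S) \<longleftrightarrow>
    (\<forall>i. ((\<lambda>x. f x $ i) has_derivative (\<lambda>h. f' h $ i)) (at x within S))"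
  by (subst has_derivative_componentwise_within) (auto simp: Basis_vec_def inner_axis)

text \<open>The Kullback-Leibler divergence of p from exp l. It is not restricted to the simplex, so
  that it has an ordinary gradient at every positive p.\<close>

definition rel_entropy :: "real ^ 'n \<Rightarrow> real ^ 'n \<Rightarrow> real" where
  "rel_entropy l p = (\<Sum>i\<in>UNIV. p $ i * (ln (p $ i) - l $ i))"

text \<open>The covariance matrix of the categorical distribution q.\<close>

abbreviation softmax_jacobian :: "real ^ 'n \<Rightarrow> real ^ 'n ^ 'n" where
  "softmax_jacobian q \<equiv> diag_mat q - outer_prod q q"

lemma sum_exp_pos: "(\<Sum>j\<in>UNIV. exp (z j :: real)) > 0" for z :: "'n::finite \<Rightarrow> real"
  by (intro sum_pos) auto

lemma softmax_nth: "softmax z $ i = exp (z $ i) / (\<Sum>j\<in>UNIV. exp (z $ j))"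
  by (simp add: softmax_def)

lemma softmax_pos: "softmax z $ i > 0"
  by (simp add: softmax_nth sum_exp_pos)

lemma softmax_sum: "(\<Sum>i\<in>UNIV. softmax z $ i) = 1"
  using sum_exp_pos[of "\<lambda>j. z $ j"] by (simp add: softmax_nth flip: sum_divide_distrib)

lemma ln_softmax: "ln (softmax z $ i) = z $ i - ln (\<Sum>j\<in>UNIV. exp (z $ j))"
  using sum_exp_pos[of "\<lambda>j. z $ j"] by (simp add: softmax_nth ln_div)

lemma softmax_add_const: "softmax (\<chi> i. z $ i + c) = softmax z"
  by (simp add: vec_eq_iff softmax_nth exp_add flip: sum_distrib_right)

lemma softmax_normalized:
  "(\<Sum>i\<in>UNIV. exp (z $ i)) = 1 \<Longrightarrow> softmax z = (\<chi> i. exp (z $ i))"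
  by (simp add: softmax_def)

text \<open>Since \<open>q \<bullet> h\<close> is the mean of h under q, the matrix centres h and
  weights the result by q.\<close>

lemma softmax_jacobian_nth: "(softmax_jacobian q *v h) $ i = q $ i * (h $ i - q \<bullet> h)"
proof -
  have "(softmax_jacobian q *v h) $ i = (\<Sum>j\<in>UNIV. (if i = j then q $ i * h $ j else 0)) - (\<Sum>j\<in>UNIV. q $ i * q $ j * h $ j)"
    unfolding sum_subtractf[symmetric]
    by (auto simp: matrix_vector_mult_def diag_mat_def outer_prod_def algebra_simps intro!: sum.cong)
  also have "\<dots> = q $ i * (h $ i - q \<bullet> h)"
    by (simp add: inner_vec_def sum_distrib_left algebra_simps)
  finally show ?thesis .
qed

text \<open>Weighted deviations from the mean cancel. Hence constant vectors are orthogonal to the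
  range of the Jacobian.\<close>

lemma softmax_jacobian_orth_1:
  assumes "(\<Sum>i\<in>UNIV. q $ i) = 1"
  shows "(\<Sum>i\<in>UNIV. (softmax_jacobian q *v h) $ i) = 0"
  using assms
  by (simp add: softmax_jacobian_nth right_diff_distrib sum_subtractf inner_vec_def flip: sum_distrib_right)

text \<open>The quadratic form of a covariance matrix is a variance. Splitting one factor of the
  square leaves the mean times a sum that vanishes by orthogonality to constants.\<close>

lemma inner_softmax_jacobian:
  assumes "(\<Sum>i\<in>UNIV. q $ i) = 1"
  shows "w \<bullet> (softmax_jacobian q *v w) = (\<Sum>i\<in>UNIV. q $ i * (w $ i - q \<bullet> w)\<^sup>2)"
proof -
  have "(\<Sum>i\<in>UNIV. q $ i * (w $ i - q \<bullet> w)\<^sup>2) =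
      (\<Sum>i\<in>UNIV. w $ i * (softmax_jacobian q *v w) $ i) - (q \<bullet> w) * (\<Sum>i\<in>UNIV. (softmax_jacobian q *v w) $ i)"
    by (simp add: softmax_jacobian_nth sum_distrib_left flip: sum_subtractf)
      (simp add: algebra_simps power2_eq_square)
  then show ?thesis
    by (simp add: softmax_jacobian_orth_1[OF assms] inner_vec_def)
qed

lemma has_derivative_softmax:
  "(softmax has_derivative (\<lambda>h. softmax_jacobian (softmax z) *v h)) (at z)"
  unfolding has_derivative_vec_iff
proof
  fix i
  let ?S = "\<lambda>z. \<Sum>j\<in>UNIV. exp (z $ j)"
  have S: "?S z \<noteq> 0" using sum_exp_pos[of "\<lambda>j. z $ j"] by simp
  have "((\<lambda>z. exp (z $ i) / ?S z) has_derivative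
      (\<lambda>h. (h $ i * exp (z $ i) * ?S z - exp (z $ i) * (\<Sum>j\<in>UNIV. h $ j * exp (z $ j))) / (?S z * ?S z))) (at z)"
    using S by (auto intro!: derivative_eq_intros)
  moreover have "(h $ i * exp (z $ i) * ?S z - exp (z $ i) * (\<Sum>j\<in>UNIV. h $ j * exp (z $ j))) / (?S z * ?S z) =
      (softmax_jacobian (softmax z) *v h) $ i" for h
  proof -
    have "softmax z \<bullet> h = (\<Sum>j\<in>UNIV. h $ j * exp (z $ j)) / ?S z"
      by (simp add: inner_vec_def softmax_nth sum_divide_distrib mult.commute)
    then show ?thesis
      using S by (simp add: softmax_jacobian_nth softmax_nth diff_divide_distrib right_diff_distrib)
  qed
  ultimately show "((\<lambda>z. softmax z $ i) has_derivative (\<lambda>h. (softmax_jacobian (softmax z) *v h) $ i)) (at z)"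
    by (simp add: softmax_nth)
qed

section \<open>Derivatives of the mixed distribution, the divergence and the dual function\<close>

text \<open>Chain rule through the argument of softmax; in the quotient rule for \<eta>, l (\<eta> +
  1) - (\<eta> l + t) collapses to l - t. The derivative is joint in both variables because implicit
  differentiation needs it; the partial derivatives follow by freezing one variable.\<close>

lemma has_derivative_mix_softmax:
  fixes l t :: "real ^ 'n"
  assumes "\<eta> > -1"
  defines "q \<equiv> mix_softmax l t \<eta>"
  shows "((\<lambda>(t, \<eta>). mix_softmax l t \<eta>) has_derivative
    (\<lambda>(h, k). ((1 / (\<eta> + 1)) *\<^sub>R softmax_jacobian q) *v h +
       k *\<^sub>R ((1 / (\<eta> + 1)\<^sup>2) *\<^sub>R (softmax_jacobian q *v (l - t))))) (at (t, \<eta>))"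
proof -
  let ?z = "\<lambda>p. (snd p *\<^sub>R l + fst p) /\<^sub>R (snd p + 1)"
  have "(?z has_derivative (\<lambda>p. fst p /\<^sub>R (\<eta> + 1) + snd p *\<^sub>R ((l - t) /\<^sub>R (\<eta> + 1)\<^sup>2))) (at (t, \<eta>))"
    unfolding has_derivative_vec_iff
  proof
    fix i
    have "((\<lambda>p. (snd p * l $ i + fst p $ i) / (snd p + 1)) has_derivative
        (\<lambda>p. fst p $ i / (\<eta> + 1) + snd p * ((l $ i - t $ i) / (\<eta> + 1)\<^sup>2))) (at (t, \<eta>))"
    proof (rule has_derivative_eq_rhs)
      show "((\<lambda>p. (snd p * l $ i + fst p $ i) / (snd p + 1)) has_derivative
          (\<lambda>p. ((snd p * l $ i + fst p $ i) * (\<eta> + 1) - (\<eta> * l $ i + t $ i) * snd p) / ((\<eta> + 1) * (\<eta> + 1)))) (at (t, \<eta>))"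
        using assms(1) by (auto intro!: derivative_eq_intros)
      show "(\<lambda>p. ((snd p * l $ i + fst p $ i) * (\<eta> + 1) - (\<eta> * l $ i + t $ i) * snd p) / ((\<eta> + 1) * (\<eta> + 1))) =
          (\<lambda>p. fst p $ i / (\<eta> + 1) + snd p * ((l $ i - t $ i) / (\<eta> + 1)\<^sup>2))"
      proof
        fix p :: "(real ^ 'n) \<times> real"
        have "fst p $ i / (\<eta> + 1) = fst p $ i * (\<eta> + 1) / (\<eta> + 1)\<^sup>2"
          using assms(1) by (simp add: power2_eq_square)
        then show "((snd p * l $ i + fst p $ i) * (\<eta> + 1) - (\<eta> * l $ i + t $ i) * snd p) / ((\<eta> + 1) * (\<eta> + 1)) =
            fst p $ i / (\<eta> + 1) + snd p * ((l $ i - t $ i) / (\<eta> + 1)\<^sup>2)"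
          unfolding power2_eq_square times_divide_eq_right
          by (simp only: add_divide_distrib[symmetric]) (simp add: algebra_simps)
      qed
    qed
    then show "((\<lambda>p. ?z p $ i) has_derivative
        (\<lambda>p. (fst p /\<^sub>R (\<eta> + 1) + snd p *\<^sub>R ((l - t) /\<^sub>R (\<eta> + 1)\<^sup>2)) $ i)) (at (t, \<eta>))"
      by (simp add: divide_inverse mult.commute mult.left_commute)
  qed
  from diff_chain_at[OF this has_derivative_softmax]
  show ?thesis
    by (simp only: o_def case_prod_unfold q_def mix_softmax_def matrix_vector_right_distrib fst_conv snd_conv
      matrix_vector_mult_scaleR scaleR_matrix_vector_assoc[symmetric] divide_inverse mult_1_left)
qed

text \<open>The product rule yields log p - l, plus 1 from differentiating the logarithm; this
  gradient is the vector v of the final formula.\<close>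

lemma has_derivative_rel_entropy:
  assumes "\<And>i. p $ i > 0"
  shows "(rel_entropy l has_derivative (\<lambda>h. (1 + log_vec p - l) \<bullet> h)) (at p)"
proof -
  have p: "p $ i \<noteq> 0" for i
    using assms[of i] by simp
  have "((\<lambda>p. \<Sum>i\<in>UNIV. p $ i * (ln (p $ i) - l $ i)) has_derivative
      (\<lambda>h. \<Sum>i\<in>UNIV. p $ i * (h $ i / p $ i) + h $ i * (ln (p $ i) - l $ i))) (at p)"
    using assms p by (auto intro!: derivative_eq_intros simp: field_simps)
  moreover have "p $ i * (h $ i / p $ i) + h $ i * (ln (p $ i) - l $ i) =
      (1 + log_vec p - l) $ i * h $ i" for h i
    using p[of i] by (simp add: log_vec_def algebra_simps)
  ultimately show ?thesis
    by (simp add: rel_entropy_def[abs_def] inner_vec_def)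
qed

lemma rel_entropy_softmax_self:
  assumes "(\<Sum>i\<in>UNIV. exp (l $ i)) = 1"
  shows "rel_entropy l (softmax l) = 0"
  using assms by (simp add: rel_entropy_def ln_softmax)

lemma mix_softmax_pos: "mix_softmax l t \<eta> $ i > 0"
  by (simp add: mix_softmax_def softmax_pos)

lemma mix_softmax_sum: "(\<Sum>i\<in>UNIV. mix_softmax l t \<eta> $ i) = 1"
  by (simp add: mix_softmax_def softmax_sum)

text \<open>In this form the limit \<eta> \<rightarrow> \<infinity> and the degenerate case of
  constant t - l can be read off.\<close>

lemma mix_softmax_alt:
  assumes "\<eta> > -1"
  shows "mix_softmax l t \<eta> = softmax (l + (1 / (\<eta> + 1)) *\<^sub>R (t - l))"
proof -
  have "(\<eta> *\<^sub>R l + t) /\<^sub>R (\<eta> + 1) = l + (1 / (\<eta> + 1)) *\<^sub>R (t - l)"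
    using assms by (simp add: vec_eq_iff field_simps)
  then show ?thesis
    by (simp add: mix_softmax_def)
qed

lemma ln_mix_softmax:
  assumes "\<eta> > -1"
  shows "ln (mix_softmax l t \<eta> $ i) - l $ i =
    (t $ i - l $ i) / (\<eta> + 1) - ln (\<Sum>j\<in>UNIV. exp ((t $ j + \<eta> * l $ j) / (\<eta> + 1)))"
proof -
  have "(t $ j + \<eta> * l $ j) / (\<eta> + 1) = l $ j + (t $ j - l $ j) / (\<eta> + 1)" for j
    using assms by (simp add: field_simps)
  then show ?thesis
    using assms by (simp add: mix_softmax_alt ln_softmax)
qed

text \<open>As usual in Lagrangian duality, the slope of the dual is the constraint violation. With
  S the sum inside the logarithm, both the slope plus \<epsilon> and the divergence equal - ln S -
  (\<eta> + 1) S' / S.\<close>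

lemma dual_fun_has_derivative:
  assumes "\<eta> > -1"
  shows "(dual_fun \<epsilon> l t has_real_derivative rel_entropy l (mix_softmax l t \<eta>) - \<epsilon>) (at \<eta>)"
proof -
  let ?E = "\<lambda>\<eta> i. exp ((t $ i + \<eta> * l $ i) / (\<eta> + 1))"
  let ?S = "\<lambda>\<eta>. \<Sum>i\<in>UNIV. ?E \<eta> i"
  let ?q = "mix_softmax l t \<eta>"
  define S where "S = (\<lambda>\<eta>. \<Sum>i\<in>UNIV. ?E \<eta> i)"
  have S: "S \<eta> > 0" unfolding S_def by (rule sum_exp_pos)
  have nz: "\<eta> + 1 \<noteq> 0" using assms by simp
  have q: "?q $ i = ?E \<eta> i / S \<eta>" for i
    by (simp add: S_def mix_softmax_def softmax_nth divide_inverse algebra_simps)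
  have dE: "((\<lambda>\<eta>. ?E \<eta> i) has_real_derivative ?E \<eta> i * ((l $ i - t $ i) / (\<eta> + 1)\<^sup>2)) (at \<eta>)" for i
  proof -
    have "((\<lambda>\<eta>. ?E \<eta> i) has_real_derivative
        ?E \<eta> i * ((l $ i * (\<eta> + 1) - (t $ i + \<eta> * l $ i)) / ((\<eta> + 1) * (\<eta> + 1)))) (at \<eta>)"
      using nz by (auto intro!: derivative_eq_intros)
    then show ?thesis
      by (simp add: algebra_simps power2_eq_square)
  qed
  define dS where "dS = (\<Sum>i\<in>UNIV. ?E \<eta> i * ((l $ i - t $ i) / (\<eta> + 1)\<^sup>2))"
  have dS: "(S has_real_derivative dS) (at \<eta>)"
    unfolding dS_def S_def by (intro DERIV_sum dE)
  have "((\<lambda>\<eta>. - \<eta> * \<epsilon> - (\<eta> + 1) * ln (S \<eta>)) has_real_derivative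
      - \<epsilon> - (ln (S \<eta>) + (\<eta> + 1) * (dS / S \<eta>))) (at \<eta>)"
    using S by (auto intro!: derivative_eq_intros dS)
  \<comment> \<open>The log-ratio of q to exp l is (t - l) / (\<eta> + 1) - ln S, and S' / S is the
    q-mean of (l - t) / (\<eta> + 1)^2.\<close>
  moreover have "rel_entropy l ?q = - ln (S \<eta>) - (\<eta> + 1) * (dS / S \<eta>)"
  proof -
    have "rel_entropy l ?q = (\<Sum>i\<in>UNIV. ?q $ i * ((t $ i - l $ i) / (\<eta> + 1)) - ln (S \<eta>) * ?q $ i)"
      unfolding rel_entropy_def ln_mix_softmax[OF assms] S_def by (simp add: algebra_simps)
    also have "\<dots> = (\<Sum>i\<in>UNIV. ?q $ i * ((t $ i - l $ i) / (\<eta> + 1))) - ln (S \<eta>)"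
      by (simp add: sum_subtractf mix_softmax_sum flip: sum_distrib_left)
    also have "(\<Sum>i\<in>UNIV. ?q $ i * ((t $ i - l $ i) / (\<eta> + 1))) = - ((\<eta> + 1) * (dS / S \<eta>))"
    proof -
      have "?q $ i * ((t $ i - l $ i) / (\<eta> + 1)) =
          - ((\<eta> + 1) * (?E \<eta> i * ((l $ i - t $ i) / (\<eta> + 1)\<^sup>2) / S \<eta>))" for i
      proof -
        have "(t $ i - l $ i) / (\<eta> + 1) = - ((\<eta> + 1) * ((l $ i - t $ i) / (\<eta> + 1)\<^sup>2))"
          using nz by (simp add: power2_eq_square minus_divide_left)
        then show ?thesis
          unfolding q by (simp add: mult.commute mult.left_commute)
      qed
      then show ?thesis
        by (simp add: dS_def sum_distrib_left sum_divide_distrib sum_negf)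
    qed
    finally show ?thesis
      by simp
  qed
  then have slope: "- \<epsilon> - (ln (S \<eta>) + (\<eta> + 1) * (dS / S \<eta>)) = rel_entropy l ?q - \<epsilon>"
    by simp
  ultimately show ?thesis
    by (simp only: slope dual_fun_def[abs_def] S_def)
qed

lemma has_derivative_rel_entropy_mix_softmax:
  fixes l t :: "real ^ 'n"
  assumes "\<eta> > -1"
  defines "q \<equiv> mix_softmax l t \<eta>"
  shows "((\<lambda>(t, \<eta>). rel_entropy l (mix_softmax l t \<eta>)) has_derivative
    (\<lambda>(h, k). (1 + log_vec q - l) \<bullet> (((1 / (\<eta> + 1)) *\<^sub>R softmax_jacobian q) *v h) +
       ((1 + log_vec q - l) \<bullet> ((1 / (\<eta> + 1)\<^sup>2) *\<^sub>R (softmax_jacobian q *v (l - t)))) * k)) (at (t, \<eta>))"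
proof -
  have "(rel_entropy l has_derivative (\<lambda>h. (1 + log_vec q - l) \<bullet> h))
      (at (case (t, \<eta>) of (t, \<eta>) \<Rightarrow> mix_softmax l t \<eta>))"
    unfolding q_def prod.case by (rule has_derivative_rel_entropy) (rule mix_softmax_pos)
  from diff_chain_at[OF has_derivative_mix_softmax[OF assms(1)] this] show ?thesis
    unfolding o_def case_prod_beta q_def inner_add_right inner_scaleR_right[of _ "snd _"]
    by (simp add: mult.commute[of _ "snd _"])
qed

lemma isCont_rel_entropy_mix_softmax:
  assumes "\<eta> > -1"
  shows "isCont (\<lambda>t. rel_entropy l (mix_softmax l t \<eta>)) t"
    and "isCont (\<lambda>\<eta>. rel_entropy l (mix_softmax l t \<eta>)) \<eta>"
proof -
  have c: "isCont (\<lambda>(t, \<eta>). rel_entropy l (mix_softmax l t \<eta>)) (t, \<eta>)"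
    using has_derivative_continuous[OF has_derivative_rel_entropy_mix_softmax[OF assms]] .
  show "isCont (\<lambda>t. rel_entropy l (mix_softmax l t \<eta>)) t"
    using isCont_o2[of t "\<lambda>t. (t, \<eta>)", OF _ c] by simp
  show "isCont (\<lambda>\<eta>. rel_entropy l (mix_softmax l t \<eta>)) \<eta>"
    using isCont_o2[of \<eta> "\<lambda>\<eta>. (t, \<eta>)", OF _ c] by simp
qed

section \<open>Monotonicity of the divergence in the multiplier\<close>

text \<open>The gradient 1 + log q - l is a constant vector plus (t - l) / (\<eta> + 1). The
  Jacobian kills the constant part, and the rest produces the variance of t - l; the sign comes from
  l - t.\<close>

lemma rel_entropy_mix_softmax_slope:
  fixes l t :: "real ^ 'n"
  assumes "\<eta> > -1"
  defines "q \<equiv> mix_softmax l t \<eta>"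
  shows "(1 + log_vec q - l) \<bullet> ((1 / (\<eta> + 1)\<^sup>2) *\<^sub>R (softmax_jacobian q *v (l - t))) =
    - (\<Sum>i\<in>UNIV. q $ i * ((t - l) $ i - q \<bullet> (t - l))\<^sup>2) / (\<eta> + 1) ^ 3"
proof -
  define w where "w = t - l"
  define s where "s = ln (\<Sum>j\<in>UNIV. exp ((t $ j + \<eta> * l $ j) / (\<eta> + 1)))"
  let ?J = "softmax_jacobian q"
  have v: "(1 + log_vec q - l) $ i = (1 - s) + w $ i / (\<eta> + 1)" for i
    using ln_mix_softmax[OF assms(1), of l t i] by (simp add: log_vec_def q_def w_def s_def)
  have "(1 + log_vec q - l) \<bullet> (?J *v w) =
      (1 - s) * (\<Sum>i\<in>UNIV. (?J *v w) $ i) + w \<bullet> (?J *v w) / (\<eta> + 1)"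
    unfolding inner_vec_def v
    by (simp add: distrib_right sum.distrib sum_distrib_left sum_divide_distrib
      del: vector_minus_component matrix_vector_mult_diff_rdistrib)
  also have "\<dots> = (\<Sum>i\<in>UNIV. q $ i * (w $ i - q \<bullet> w)\<^sup>2) / (\<eta> + 1)"
    by (simp add: softmax_jacobian_orth_1 inner_softmax_jacobian q_def mix_softmax_sum)
  finally have *: "(1 + log_vec q - l) \<bullet> (?J *v w) = (\<Sum>i\<in>UNIV. q $ i * (w $ i - q \<bullet> w)\<^sup>2) / (\<eta> + 1)" .
  have "?J *v (l - t) = - (?J *v w)"
    by (simp add: w_def matrix_vector_mult_diff_distrib)
  then show ?thesis
    using assms(1) * by (simp add: w_def power3_eq_cube power2_eq_square)
qed

text \<open>Zero variance under positive weights makes t - l constant, so the mixed distribution is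
  exp l, with divergence 0. The weights p are independent of \<eta>: a nonzero divergence at one
  multiplier gives positive variance at all of them.\<close>

lemma mix_softmax_variance_pos:
  assumes "(\<Sum>i\<in>UNIV. exp (l $ i)) = 1" and "\<eta> > -1" and "rel_entropy l (mix_softmax l t \<eta>) \<noteq> 0"
    and "\<And>i. p $ i > 0"
  shows "(\<Sum>i\<in>UNIV. p $ i * ((t - l) $ i - p \<bullet> (t - l))\<^sup>2) > 0"
proof -
  define m where "m = p \<bullet> (t - l)"
  have nn: "p $ i * ((t - l) $ i - m)\<^sup>2 \<ge> 0" for i
    using assms(4)[of i] by simp
  have "(\<Sum>i\<in>UNIV. p $ i * ((t - l) $ i - m)\<^sup>2) \<noteq> 0"
  proof
    assume "(\<Sum>i\<in>UNIV. p $ i * ((t - l) $ i - m)\<^sup>2) = 0"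
    then have "p $ i * ((t - l) $ i - m)\<^sup>2 = 0" for i
      using nn by (subst (asm) sum_nonneg_eq_0_iff) auto
    then have "t $ i - l $ i = m" for i
      using assms(4)[of i] by (auto simp: less_le)
    then have "l + (1 / (\<eta> + 1)) *\<^sub>R (t - l) = (\<chi> i. l $ i + m / (\<eta> + 1))"
      by (simp add: vec_eq_iff)
    then have "mix_softmax l t \<eta> = softmax l"
      using assms(2) by (simp add: mix_softmax_alt softmax_add_const)
    then show False
      using assms(1,3) by (simp add: rel_entropy_softmax_self)
  qed
  then show ?thesis
    using sum_nonneg[of UNIV "\<lambda>i. p $ i * ((t - l) $ i - m)\<^sup>2"] nn by (auto simp: m_def less_le)
qed

lemma rel_entropy_mix_softmax_DERIV:
  fixes l t :: "real ^ 'n"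
  assumes "\<eta> > -1"
  defines "q \<equiv> mix_softmax l t \<eta>"
  shows "((\<lambda>\<eta>. rel_entropy l (mix_softmax l t \<eta>)) has_real_derivative
    - (\<Sum>i\<in>UNIV. q $ i * ((t - l) $ i - q \<bullet> (t - l))\<^sup>2) / (\<eta> + 1) ^ 3) (at \<eta>)"
proof -
  have "((\<lambda>\<eta>. (t, \<eta>)) has_derivative (\<lambda>k. (0, k))) (at \<eta>)"
    by (auto intro!: derivative_eq_intros)
  note chain = diff_chain_at[OF this has_derivative_rel_entropy_mix_softmax[OF assms(1), of l t],
      unfolded o_def prod.case rel_entropy_mix_softmax_slope[OF assms(1)]]
  show ?thesis
    unfolding has_field_derivative_def q_def
    by (rule has_derivative_eq_rhs[OF chain]) (simp add: fun_eq_iff)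
qed

lemma rel_entropy_mix_softmax_antimono:
  assumes "-1 < a" "a \<le> b"
  shows "rel_entropy l (mix_softmax l t b) \<le> rel_entropy l (mix_softmax l t a)"
proof (rule DERIV_nonpos_imp_nonincreasing[OF assms(2)])
  fix x assume "a \<le> x"
  then have x: "x > -1" using assms by simp
  have "- (\<Sum>i\<in>UNIV. p $ i * ((t - l) $ i - p \<bullet> (t - l))\<^sup>2) / (x + 1) ^ 3 \<le> 0"
    if "\<And>i. p $ i > 0" for p
    using x that by (auto intro!: divide_nonneg_pos sum_nonneg mult_nonneg_nonneg simp: less_imp_le)
  from rel_entropy_mix_softmax_DERIV[OF x] this[OF mix_softmax_pos]
  show "\<exists>y. ((\<lambda>\<eta>. rel_entropy l (mix_softmax l t \<eta>)) has_real_derivative y) (at x) \<and> y \<le> 0"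
    by blast
qed

text \<open>The multiplier \<eta> only witnesses that t - l is not constant; it need not lie between
  a and b.\<close>

lemma rel_entropy_mix_softmax_strict_antimono:
  assumes "(\<Sum>i\<in>UNIV. exp (l $ i)) = 1" and "\<eta> > -1" and "rel_entropy l (mix_softmax l t \<eta>) \<noteq> 0"
    and "-1 < a" "a < b"
  shows "rel_entropy l (mix_softmax l t b) < rel_entropy l (mix_softmax l t a)"
proof (rule DERIV_neg_imp_decreasing[OF assms(5)])
  fix x assume "a \<le> x"
  then have x: "x > -1" using assms by simp
  have "- (\<Sum>i\<in>UNIV. mix_softmax l t x $ i * ((t - l) $ i - mix_softmax l t x \<bullet> (t - l))\<^sup>2) / (x + 1) ^ 3 < 0"
    using x mix_softmax_variance_pos[OF assms(1-3) mix_softmax_pos] by (auto intro!: divide_neg_pos)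
  with rel_entropy_mix_softmax_DERIV[OF x]
  show "\<exists>y. ((\<lambda>\<eta>. rel_entropy l (mix_softmax l t \<eta>)) has_real_derivative y) (at x) \<and> y < 0"
    by blast
qed

section \<open>Characterization of the maximizer\<close>

text \<open>The sign of the slope makes the dual strictly increasing up to \<eta> and strictly
  decreasing afterwards. Hence \<eta> is the only maximizer, as the definite description
  requires.\<close>

lemma eta_star_eqI:
  assumes "\<eta> \<ge> 0"
    and gt: "\<And>x. 0 \<le> x \<Longrightarrow> x < \<eta> \<Longrightarrow> rel_entropy l (mix_softmax l t x) > \<epsilon>"
    and lt: "\<And>x. \<eta> < x \<Longrightarrow> rel_entropy l (mix_softmax l t x) < \<epsilon>"
  shows "eta_star \<epsilon> l t = \<eta>"
proof -
  \<comment> \<open>The slope may vanish at \<eta> itself, so strict monotonicity is derived from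
    its sign on open intervals and continuity up to the endpoints.\<close>
  have cont: "continuous_on {a..b} (dual_fun \<epsilon> l t)" if "a \<ge> 0" for a b
    using that by (intro continuous_at_imp_continuous_on ballI DERIV_isCont[OF dual_fun_has_derivative]) auto
  have less: "dual_fun \<epsilon> l t x < dual_fun \<epsilon> l t \<eta>" if "x \<ge> 0" "x \<noteq> \<eta>" for x
  proof (cases "x < \<eta>")
    case True
    then show ?thesis
    proof (rule DERIV_pos_imp_increasing_open[OF _ _ cont[OF \<open>x \<ge> 0\<close>]])
      fix y assume "x < y" "y < \<eta>"
      then show "\<exists>d. (dual_fun \<epsilon> l t has_real_derivative d) (at y) \<and> d > 0"
        using dual_fun_has_derivative[of y \<epsilon> l t] gt[of y] that by auto
    qed
  next
    case False
    with that have "\<eta> < x" by simp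
    then show ?thesis
    proof (rule DERIV_neg_imp_decreasing_open[OF _ _ cont[OF assms(1)]])
      fix y assume "\<eta> < y" "y < x"
      then show "\<exists>d. (dual_fun \<epsilon> l t has_real_derivative d) (at y) \<and> d < 0"
        using dual_fun_has_derivative[of y \<epsilon> l t] lt[of y] assms(1) by auto
    qed
  qed
  show ?thesis
    unfolding eta_star_def is_arg_max_def
  proof (rule the_equality)
    show "0 \<le> \<eta> \<and> \<not> (\<exists>y. 0 \<le> y \<and> dual_fun \<epsilon> l t \<eta> < dual_fun \<epsilon> l t y)"
      using assms(1) less by (metis less_asym less_irrefl)
  qed (use assms(1) less in blast)
qed

lemma eta_star_eq_0:
  assumes "rel_entropy l (mix_softmax l t 0) < \<epsilon>"
  shows "eta_star \<epsilon> l t = 0"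
proof (rule eta_star_eqI)
  fix x :: real assume "0 < x"
  then show "rel_entropy l (mix_softmax l t x) < \<epsilon>"
    using rel_entropy_mix_softmax_antimono[of 0 x l t] assms by simp
qed auto

text \<open>The intermediate value theorem supplies a solution of divergence = \<epsilon>, and
  strict decrease makes it the only sign change of the slope. The bracketing conditions are strict
  inequalities at fixed multipliers, hence stable under small changes of t.\<close>

lemma eta_star_between:
  assumes l: "(\<Sum>i\<in>UNIV. exp (l $ i)) = 1" and "\<epsilon> > 0" and "0 \<le> a" "a \<le> b"
    and a: "rel_entropy l (mix_softmax l t a) > \<epsilon>" and b: "rel_entropy l (mix_softmax l t b) < \<epsilon>"
  shows "a < eta_star \<epsilon> l t" "eta_star \<epsilon> l t < b"
    and "rel_entropy l (mix_softmax l t (eta_star \<epsilon> l t)) = \<epsilon>"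
proof -
  let ?r = "\<lambda>x. rel_entropy l (mix_softmax l t x)"
  obtain x where x: "a \<le> x" "x \<le> b" "?r x = \<epsilon>"
    using IVT2[of ?r b \<epsilon> a] a b assms(3,4) isCont_rel_entropy_mix_softmax(2)[of _ l t]
    by (auto simp: less_imp_le)
  \<comment> \<open>A divergence above \<epsilon> > 0 is nonzero, which excludes constant t -
    l.\<close>
  have "?r a \<noteq> 0" "a > -1" using a assms(2,3) by auto
  note strict = rel_entropy_mix_softmax_strict_antimono[OF l this(2,1)]
  have "eta_star \<epsilon> l t = x"
  proof (rule eta_star_eqI)
    show "?r y > \<epsilon>" if "0 \<le> y" "y < x" for y
      using strict[of y x] that x by simp
    show "?r y < \<epsilon>" if "x < y" for y
      using strict[of x y] that x assms(3) by simp
  qed (use x assms in simp)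
  moreover have "a \<noteq> x" "x \<noteq> b"
    using a b x by auto
  ultimately show "a < eta_star \<epsilon> l t" "eta_star \<epsilon> l t < b" "?r (eta_star \<epsilon> l t) = \<epsilon>"
    using x by auto
qed

text \<open>The mixed distribution tends to exp l, and the divergence is continuous there. This
  provides the upper end of a bracket.\<close>

lemma tendsto_rel_entropy_mix_softmax:
  assumes "(\<Sum>i\<in>UNIV. exp (l $ i)) = 1"
  shows "((\<lambda>\<eta>. rel_entropy l (mix_softmax l t \<eta>)) \<longlongrightarrow> 0) at_top"
proof -
  have "((\<lambda>\<eta>::real. 1 / (\<eta> + 1)) \<longlongrightarrow> 0) at_top"
    using filterlim_tendsto_add_at_top[OF tendsto_const[of "1::real"] filterlim_ident]
    by (intro tendsto_divide_0[OF tendsto_const] filterlim_at_top_imp_at_infinity)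
      (simp add: add.commute)
  then have "((\<lambda>\<eta>::real. l + (1 / (\<eta> + 1)) *\<^sub>R (t - l)) \<longlongrightarrow> l + 0 *\<^sub>R (t - l)) at_top"
    by (intro tendsto_intros)
  then have "((\<lambda>\<eta>::real. softmax (l + (1 / (\<eta> + 1)) *\<^sub>R (t - l))) \<longlongrightarrow> softmax l) at_top"
    using has_derivative_continuous[OF has_derivative_softmax] by (intro isCont_tendsto_compose[of l softmax]) auto
  then have "((\<lambda>\<eta>::real. rel_entropy l (softmax (l + (1 / (\<eta> + 1)) *\<^sub>R (t - l)))) \<longlongrightarrow> rel_entropy l (softmax l)) at_top"
    using has_derivative_continuous[OF has_derivative_rel_entropy[OF softmax_pos]]
    by (intro isCont_tendsto_compose[of _ "rel_entropy l"])
  then have "((\<lambda>\<eta>::real. rel_entropy l (softmax (l + (1 / (\<eta> + 1)) *\<^sub>R (t - l)))) \<longlongrightarrow> 0) at_top"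
    by (simp add: rel_entropy_softmax_self[OF assms])
  moreover have "\<forall>\<^sub>F \<eta> in at_top. rel_entropy l (softmax (l + (1 / (\<eta> + 1)) *\<^sub>R (t - l))) = rel_entropy l (mix_softmax l t \<eta>)"
    using eventually_gt_at_top[of "-1"] by eventually_elim (simp add: mix_softmax_alt)
  ultimately show ?thesis
    by (rule Lim_transform_eventually)
qed

text \<open>Normalization of t enters here: at \<eta> = 0 the softmax returns exp t, so the two
  cases of the theorem are the signs of the dual slope at 0.\<close>

lemma rel_entropy_mix_softmax_0:
  assumes "(\<Sum>i\<in>UNIV. exp (t $ i)) = 1"
  shows "rel_entropy l (mix_softmax l t 0) = (\<Sum>i\<in>UNIV. exp (t $ i) * (t $ i - l $ i))"
  using assms by (simp add: mix_softmax_def softmax_normalized rel_entropy_def)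

section \<open>Derivative of the optimal multiplier\<close>

theorem mainTheorem2:
  fixes l t q :: "real ^ 'n" and \<epsilon> \<eta> :: real
  assumes "\<epsilon> > 0"
    and "(\<Sum>i\<in>UNIV. exp (l $ i)) = 1"
    and "(\<Sum>i\<in>UNIV. exp (t $ i)) = 1"
    and "\<eta> = eta_star \<epsilon> l t"
    and "q = mix_softmax l t \<eta>"
  shows
    "((\<Sum>i\<in>UNIV. exp (t $ i) * (t $ i - l $ i)) < \<epsilon> \<longrightarrow>
        \<eta> = 0 \<and> (eta_star \<epsilon> l has_derivative (\<lambda>h. 0)) (at t)) \<and>
     ((\<Sum>i\<in>UNIV. exp (t $ i) * (t $ i - l $ i)) > \<epsilon> \<longrightarrow>
        (let v = 1 + log_vec q - l;
             dq_dt = (1 / (\<eta> + 1)) *\<^sub>R (diag_mat q - outer_prod q q);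
             dq_deta = (1 / (\<eta> + 1)\<^sup>2) *\<^sub>R ((diag_mat q - outer_prod q q) *v (l - t))
         in \<eta> > 0 \<and>
            ((\<lambda>t'. mix_softmax l t' \<eta>) has_derivative (\<lambda>h. dq_dt *v h)) (at t) \<and>
            ((\<lambda>\<eta>'. mix_softmax l t \<eta>') has_vector_derivative dq_deta) (at \<eta>) \<and>
            - (v \<bullet> dq_deta) \<noteq> 0 \<and>
            (eta_star \<epsilon> l has_derivative
               (\<lambda>h. ((1 / (- (v \<bullet> dq_deta))) *\<^sub>R (v v* dq_dt)) \<bullet> h)) (at t)))"
proof -
  let ?r = "\<lambda>t \<eta>. rel_entropy l (mix_softmax l t \<eta>)"
  have tendsto_r: "((\<lambda>t. ?r t x) \<longlongrightarrow> ?r t x) (nhds t)" if "x > -1" for x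
    using isCont_rel_entropy_mix_softmax(1)[OF that, where l = l and t = t]
    unfolding isCont_def tendsto_at_iff_tendsto_nhds[of "\<lambda>t. ?r t x"] .
  note at0 = rel_entropy_mix_softmax_0[OF assms(3), of l, symmetric]
  show ?thesis
  proof (intro conjI impI)
    assume "(\<Sum>i\<in>UNIV. exp (t $ i) * (t $ i - l $ i)) < \<epsilon>"
    then have lt: "?r t 0 < \<epsilon>"
      by (simp add: at0)
    then show "\<eta> = 0"
      by (simp add: assms(4) eta_star_eq_0)
    \<comment> \<open>The strict inequality persists near t, so the maximizer is locally
      constant.\<close>
    have "\<forall>\<^sub>F t in nhds t. ?r t 0 < \<epsilon>"
      using tendsto_r[of 0] lt by (simp add: order_tendstoD)
    then have "\<forall>\<^sub>F t in nhds t. 0 = eta_star \<epsilon> l t"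
      by eventually_elim (simp add: eta_star_eq_0)
    then show "(eta_star \<epsilon> l has_derivative (\<lambda>h. 0)) (at t)"
      by (intro has_derivative_transform_eventually[OF has_derivative_const])
        (auto simp: eventually_nhds_conv_at)
  next
    assume "(\<Sum>i\<in>UNIV. exp (t $ i) * (t $ i - l $ i)) > \<epsilon>"
    then have gt: "?r t 0 > \<epsilon>"
      by (simp add: at0)
    define v where "v = 1 + log_vec q - l"
    define dq_dt where "dq_dt = (1 / (\<eta> + 1)) *\<^sub>R (diag_mat q - outer_prod q q)"
    define dq_deta where "dq_deta = (1 / (\<eta> + 1)\<^sup>2) *\<^sub>R ((diag_mat q - outer_prod q q) *v (l - t))"
    have "\<forall>\<^sub>F b in at_top. 0 \<le> b \<and> ?r t b < \<epsilon>"
      using order_tendstoD(2)[OF tendsto_rel_entropy_mix_softmax[OF assms(2)] assms(1)]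
      by (intro eventually_conj eventually_ge_at_top)
    then obtain b where "0 \<le> b" "?r t b < \<epsilon>"
      by (metis (no_types, lifting) eventually_happens trivial_limit_at_top_linorder)
    note eta = eta_star_between[OF assms(2,1) order_refl this(1) gt this(2), folded assms(4)]
    have "\<eta> > -1" using eta by simp
    note strict = rel_entropy_mix_softmax_strict_antimono[OF assms(2) this, of t]
    \<comment> \<open>Any bracket of \<eta> at t remains a bracket for nearby t'. Small brackets
      give continuity of the maximizer; a fixed one gives the equation on a neighbourhood.\<close>
    have near: "\<forall>\<^sub>F t' in nhds t. a < eta_star \<epsilon> l t' \<and> eta_star \<epsilon> l t' < b \<and> ?r t' (eta_star \<epsilon> l t') = \<epsilon>"
      if "0 \<le> a" "a < \<eta>" "\<eta> < b" for a b
    proof -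
      have "?r t a > \<epsilon>" "?r t b < \<epsilon>"
        using strict[of a \<eta>] strict[of \<eta> b] that eta(3) assms(1) by auto
      then have "\<forall>\<^sub>F t' in nhds t. ?r t' a > \<epsilon>" "\<forall>\<^sub>F t' in nhds t. ?r t' b < \<epsilon>"
        using that order_tendstoD[OF tendsto_r[of a]] order_tendstoD[OF tendsto_r[of b]] by auto
      then show ?thesis
      proof eventually_elim
        case (elim t')
        then show ?case
          using eta_star_between[OF assms(2,1) \<open>0 \<le> a\<close> _ elim] that by simp
      qed
    qed
    have cont: "isCont (eta_star \<epsilon> l) t"
      unfolding isCont_def tendsto_at_iff_tendsto_nhds
    proof (rule order_tendstoI)
      fix a assume "a < eta_star \<epsilon> l t"
      then show "\<forall>\<^sub>F t' in nhds t. a < eta_star \<epsilon> l t'"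
        \<comment> \<open>Brackets must start at a nonnegative multiplier; \<eta> > 0 keeps
          \<open>max a 0\<close> below \<eta>. The upper end is arbitrary.\<close>
        using near[of "max a 0" "\<eta> + 1"] eta(1) assms(4) by (auto elim: eventually_mono)
    next
      fix b assume "eta_star \<epsilon> l t < b"
      then show "\<forall>\<^sub>F t' in nhds t. eta_star \<epsilon> l t' < b"
        using near[of 0 b] eta(1) assms(4) by (auto elim: eventually_mono)
    qed
    have joint: "((\<lambda>(t, \<eta>). mix_softmax l t \<eta>) has_derivative (\<lambda>(h, k). dq_dt *v h + k *\<^sub>R dq_deta)) (at (t, \<eta>))"
      using has_derivative_mix_softmax[OF \<open>\<eta> > -1\<close>, of l t] by (simp add: dq_dt_def dq_deta_def assms(5))
    have 1: "((\<lambda>t'. mix_softmax l t' \<eta>) has_derivative (\<lambda>h. dq_dt *v h)) (at t)"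
    proof -
      have "((\<lambda>t'. (t', \<eta>)) has_derivative (\<lambda>h. (h, 0))) (at t)"
        by (auto intro!: derivative_eq_intros)
      from diff_chain_at[OF this joint] show ?thesis by (simp add: o_def)
    qed
    have 2: "((\<lambda>\<eta>'. mix_softmax l t \<eta>') has_vector_derivative dq_deta) (at \<eta>)"
    proof -
      have "((\<lambda>\<eta>'. (t, \<eta>')) has_derivative (\<lambda>k. (0, k))) (at \<eta>)"
        by (auto intro!: derivative_eq_intros)
      from diff_chain_at[OF this joint] show ?thesis by (simp add: o_def has_vector_derivative_def)
    qed
    have "?r t \<eta> \<noteq> 0"
      using eta(3) assms(1) by simp
    \<comment> \<open>This product is minus a variance over (\<eta> + 1)^3, and the divergence
      \<epsilon> \<noteq> 0 at \<eta> makes the variance positive.\<close>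
    then have 3: "v \<bullet> dq_deta \<noteq> 0"
      using mix_softmax_variance_pos[OF assms(2) \<open>\<eta> > -1\<close> _ mix_softmax_pos, of t l t \<eta>]
        rel_entropy_mix_softmax_slope[OF \<open>\<eta> > -1\<close>, of l t] \<open>\<eta> > -1\<close>
      by (simp add: v_def dq_deta_def assms(5))
    have 4: "(eta_star \<epsilon> l has_derivative
               (\<lambda>h. ((1 / (- (v \<bullet> dq_deta))) *\<^sub>R (v v* dq_dt)) \<bullet> h)) (at t)"
    proof -
      have "(eta_star \<epsilon> l has_derivative (\<lambda>h. - (v \<bullet> (dq_dt *v h)) / (v \<bullet> dq_deta))) (at t)"
      proof (rule has_derivative_implicit_scalar)
        show "((\<lambda>(t, \<eta>). ?r t \<eta> - \<epsilon>) has_derivative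
            (\<lambda>(h, k). v \<bullet> (dq_dt *v h) + v \<bullet> dq_deta * k)) (at (t, eta_star \<epsilon> l t))"
          using has_derivative_diff[OF has_derivative_rel_entropy_mix_softmax[OF \<open>\<eta> > -1\<close>, of l t] has_derivative_const[of \<epsilon>]]
          by (simp add: v_def dq_dt_def dq_deta_def assms(5) case_prod_unfold flip: assms(4))
        show "bounded_linear (\<lambda>h. v \<bullet> (dq_dt *v h))"
          by (intro bounded_linear_compose[OF bounded_linear_inner_right] matrix_vector_mul_bounded_linear)
        show "\<forall>\<^sub>F y in nhds t. (case (y, eta_star \<epsilon> l y) of (t, \<eta>) \<Rightarrow> ?r t \<eta> - \<epsilon>) = 0"
          using near[OF order_refl eta(1,2)] by eventually_elim simp
      qed (use 3 cont in auto)
      \<comment> \<open>Transposition turns \<open>v \<bullet> (dq_dt *v h)\<close> into the row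
        vector \<open>v v* dq_dt\<close> applied to h; the minus sign moves into the
        denominator.\<close>
      then show ?thesis
        by (simp add: dot_lmul_matrix[symmetric])
    qed
    show "let v = 1 + log_vec q - l;
             dq_dt = (1 / (\<eta> + 1)) *\<^sub>R (diag_mat q - outer_prod q q);
             dq_deta = (1 / (\<eta> + 1)\<^sup>2) *\<^sub>R ((diag_mat q - outer_prod q q) *v (l - t))
         in \<eta> > 0 \<and>
            ((\<lambda>t'. mix_softmax l t' \<eta>) has_derivative (\<lambda>h. dq_dt *v h)) (at t) \<and>
            ((\<lambda>\<eta>'. mix_softmax l t \<eta>') has_vector_derivative dq_deta) (at \<eta>) \<and>
            - (v \<bullet> dq_deta) \<noteq> 0 \<and>
            (eta_star \<epsilon> l has_derivative
               (\<lambda>h. ((1 / (- (v \<bullet> dq_deta))) *\<^sub>R (v v* dq_dt)) \<bullet> h)) (at t)"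
      using eta(1) 1 2 3 4 unfolding Let_def v_def dq_dt_def dq_deta_def neg_equal_0_iff_equal
        by (intro conjI)
  qed
qed

end
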